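(* Let $0<q<1$, $\alpha\in\mathbb{R}$ with $|\alpha|>1$, $\lambda>0$, $j\in\mathbb{N}$, and let $\{\mathbb{H}_n(x;q)\}_{n\ge0}$ be the $q$-Hermite I-Sobolev type polynomials. Then for every integer $n\ge1$, $$\mathbb{H}_n(x;q)=H_n(x;q)-\lambda\,\frac{[n]_q^{(j)}H_{n-j}(\alpha;q)}{1+\lambda K_{n-1,q}^{(j,j)}(\alpha,\alpha)}\,K_{n-1,q}^{(0,j)}(x,\alpha).$$
   Context: Here $\mathbb{N}=\{0,1,2,\dots\}$ and $0<q<1$. Notation: $(a;q)_n=\prod_{i=0}^{n-1}(1-aq^i)$ (also for $n=\infty$), $(a_1,\dots,a_r;q)_n=\prod_i(a_i;q)_n$; $[n]_q=\frac{1-q^n}{1-q}$; $[n]_q^{(k)}=\frac{(q^{-n};q)_k}{(q-1)^k}q^{kn-\binom{k}{2}}$ (equal to $[n]_q[n-1]_q\cdots[n-k+1]_q$). The $q$-derivative is $D_qf(x)=\frac{f(qx)-f(x)}{(q-1)x}$ for $x\ne0$ (and $f'(0)$ at $x=0$), $D_q^0f=f$, $D_q^k=D_q D_q^{k-1}$. Monic $q$-Hermite I polynomials: $H_n(x;q)=q^{\binom n2}\sum_{k=0}^n\frac{(q^{-n};q)_k(x^{-1};q)_k}{(q;q)_k}(-qx)^k$ for $n\ge0$, and $H_m=0$ for $m<0$; equivalently $H_0=1$, $xH_n=H_{n+1}+\gamma_nH_{n-1}$ with $\gamma_n=q^{n-1}(1-q^n)$. Put $\|H_n\|^2=(1-q)(q;q)_n(q,-1,-q;q)_\infty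 q^{\binom n2}$ and $K_{n,q}^{(i,l)}(x,y)=\sum_{k=0}^n\frac{(D_q^iH_k)(x;q)\,(D_q^lH_k)(y;q)}{\|H_k\|^2}$. Sobolev inner product (on real polynomials): $\langle f,g\rangle_\lambda=\int_{-1}^1f(x)g(x)(qx,-qx;q)_\infty d_qx+\lambda (D_q^jf)(\alpha)(D_q^jg)(\alpha)$, where $\int_{-1}^1h(t)d_qt=(1-q)\sum_{m\ge0}q^m\big(h(q^m)+h(-q^m)\big)$. $\mathbb{H}_n(x;q)$ is the monic polynomial of degree $n$, $\{\mathbb{H}_n\}$ being orthogonal with respect to $\langle\cdot,\cdot\rangle_\lambda$. *)

theory Defs
  imports "HOL-Analysis.Analysis" "HOL-Computational_Algebra.Polynomial"
begin

definition qpoch :: "real \<Rightarrow> real \<Rightarrow> nat \<Rightarrow> real" where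
  "qpoch a q n = (\<Prod>i<n. 1 - a * q ^ i)"

definition qpoch_inf :: "real \<Rightarrow> real \<Rightarrow> real" where
  "qpoch_inf a q = (\<Prod>i. 1 - a * q ^ i)"

text \<open>
  The exponent of \<open>q\<close> is an integer: it is negative when \<open>k > 2 * n + 1\<close>.
\<close>

definition qfalling :: "real \<Rightarrow> nat \<Rightarrow> nat \<Rightarrow> real" where
  "qfalling q n k =
     qpoch (q powi (- int n)) q k / (q - 1) ^ k * q powi (int k * int n - int (k choose 2))"

definition qderiv :: "real \<Rightarrow> (real \<Rightarrow> real) \<Rightarrow> real \<Rightarrow> real" where
  "qderiv q f x = (if x = 0 then deriv f 0 else (f (q * x) - f x) / ((q - 1) * x))"

text \<open>
  The hypergeometric formula for the monic \<open>q\<close>-Hermite I polynomials has the terms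
  \<open>(1/x; q)\<^sub>k (-q x)\<^sup>k\<close>. As a polynomial in \<open>x\<close>, such a term is
  \<open>(-q)\<^sup>k \<Prod>i<k. (x - q\<^sup>i)\<close>, which also gives its value at \<open>x = 0\<close>; the lemma below
  states the agreement for \<open>x \<noteq> 0\<close>. The degree is an integer so that negative indices
  give the zero polynomial.
\<close>

definition qHermite :: "real \<Rightarrow> int \<Rightarrow> real poly" where
  "qHermite q n =
     (if n < 0 then 0
      else smult (q ^ (nat n choose 2))
        (\<Sum>k\<le>nat n. smult (qpoch (q powi (- n)) q k / qpoch q q k * (- q) ^ k)
                       (\<Prod>i<k. [:- (q ^ i), 1:])))"

lemma poly_qHermite:
  assumes "x \<noteq> 0"
  shows "poly (qHermite q (int n)) x =
    q ^ (n choose 2) *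
    (\<Sum>k\<le>n. qpoch (q powi (- int n)) q k * qpoch (inverse x) q k / qpoch q q k * (- q * x) ^ k)"
proof -
  have 1: "(\<Prod>i<k. x - q ^ i) = qpoch (inverse x) q k * x ^ k" for k
    unfolding qpoch_def using assms
    by (induction k) (simp_all add: field_simps)
  have 2: "(- (q * x)) ^ k = (- q) ^ k * x ^ k" for k
    by (simp add: power_mult_distrib[symmetric])
  show ?thesis
    by (simp add: qHermite_def poly_sum poly_prod 1 2 mult.assoc mult.left_commute)
qed

definition qHermite_norm2 :: "real \<Rightarrow> nat \<Rightarrow> real" where
  "qHermite_norm2 q n =
     (1 - q) * qpoch q q n * (qpoch_inf q q * qpoch_inf (- 1) q * qpoch_inf (- q) q)
     * q ^ (n choose 2)"

definition qHermite_kernel :: "real \<Rightarrow> nat \<Rightarrow> nat \<Rightarrow> nat \<Rightarrow> real \<Rightarrow> real \<Rightarrow> real" where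
  "qHermite_kernel q n i l x y =
     (\<Sum>k\<le>n. (qderiv q ^^ i) (poly (qHermite q (int k))) x
             * (qderiv q ^^ l) (poly (qHermite q (int k))) y
             / qHermite_norm2 q k)"

definition jackson_integral :: "real \<Rightarrow> (real \<Rightarrow> real) \<Rightarrow> real" where
  "jackson_integral q h = (1 - q) * (\<Sum>m. q ^ m * (h (q ^ m) + h (- (q ^ m))))"

definition qsobolev_inner ::
    "real \<Rightarrow> real \<Rightarrow> nat \<Rightarrow> real \<Rightarrow> real poly \<Rightarrow> real poly \<Rightarrow> real" where
  "qsobolev_inner q \<alpha> j lam f g =
     jackson_integral q
       (\<lambda>x. poly f x * poly g x * (qpoch_inf (q * x) q * qpoch_inf (- (q * x)) q))
     + lam * (qderiv q ^^ j) (poly f) \<alpha> * (qderiv q ^^ j) (poly g) \<alpha>"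

definition qHermite_Sobolev_seq ::
    "real \<Rightarrow> real \<Rightarrow> nat \<Rightarrow> real \<Rightarrow> (nat \<Rightarrow> real poly) \<Rightarrow> bool" where
  "qHermite_Sobolev_seq q \<alpha> j lam S \<longleftrightarrow>
     (\<forall>n. degree (S n) = n \<and> lead_coeff (S n) = 1) \<and>
     (\<forall>m n. m \<noteq> n \<longrightarrow> qsobolev_inner q \<alpha> j lam (S m) (S n) = 0)"

end

theory Submission
  imports Defs
begin

text \<open>
  Let \<open>L\<close> be the functional that integrates a polynomial against the weight of the
  \<open>q\<close>-Hermite I polynomials \<open>H\<^sub>n\<close>. Once the \<open>H\<^sub>n\<close> are known to be orthogonal for \<open>L\<close> with the
  stated norms, the formula is linear algebra. The difference \<open>S\<^sub>n - H\<^sub>n\<close> of two monic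
  polynomials of degree \<open>n\<close> is a combination of the \<open>H\<^sub>k\<close> with \<open>k < n\<close>; since \<open>S\<^sub>n\<close> is Sobolev
  orthogonal to \<open>H\<^sub>k\<close>, its Fourier coefficients are \<open>- \<lambda> A (D\<^sub>q\<^sup>j H\<^sub>k)(\<alpha>) / \<parallel>H\<^sub>k\<parallel>\<^sup>2\<close> with the single
  unknown \<open>A = (D\<^sub>q\<^sup>j S\<^sub>n)(\<alpha>)\<close> (\<open>qHermite_Sobolev_expansion\<close>). So \<open>S\<^sub>n = H\<^sub>n - \<lambda> A K(x, \<alpha>)\<close>, and
  applying \<open>D\<^sub>q\<^sup>j\<close> at \<open>\<alpha>\<close> determines \<open>A\<close>. The numerator \<open>(D\<^sub>q\<^sup>j H\<^sub>n)(\<alpha>)\<close> comes from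
  \<open>D\<^sub>q H\<^sub>n = [n]\<^sub>q H\<^sub>n\<^sub>-\<^sub>1\<close> (\<open>funpow_qderiv_poly_qHermite\<close>).

  The orthogonality rests on two facts. The first is the three-term recurrence
  (\<open>qHermite_recurrence\<close>), which follows from \<open>D\<^sub>q H\<^sub>n = [n]\<^sub>q H\<^sub>n\<^sub>-\<^sub>1\<close> and the values \<open>H\<^sub>n(1)\<close>. The
  second is the integration by parts \<open>L(x g) = (1 - q) L(D\<^sub>q g)\<close>
  (\<open>qHermite_functional_by_parts\<close>), a telescoping sum that exploits the functional equation of
  the weight. Together they give \<open>L(H\<^sub>n) = 0\<close> for \<open>n \<ge> 1\<close>, and then the recurrence alone yields
  \<open>L(H\<^sub>m H\<^sub>n) = 0\<close> for \<open>m \<noteq> n\<close> and \<open>\<parallel>H\<^sub>n\<^sub>+\<^sub>1\<parallel>\<^sup>2 = q\<^sup>n (1 - q\<^sup>n\<^sup>+\<^sup>1) \<parallel>H\<^sub>n\<parallel>\<^sup>2\<close>. The remaining constant \<open>L(1)\<close>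
  is obtained from the asymptotics of the even moments and Euler's identity
  \<open>(q;q\<^sup>2)\<^sub>\<infinity> (-q;q)\<^sub>\<infinity> = 1\<close> (\<open>qHermite_functional_1\<close>).
\<close>

section \<open>Infinite \<open>q\<close>-shifted factorials\<close>

lemma qpoch_tendsto_qpoch_inf:
  assumes "0 < q" "q < 1"
  shows "qpoch a q \<longlonglongrightarrow> qpoch_inf a q"
    and "convergent_prod (\<lambda>i. 1 - a * q ^ i)"
proof -
  have "summable (\<lambda>i. norm ((1 - a * q ^ i) - 1))"
    using assms by (auto simp: abs_mult intro!: summable_mult summable_geometric)
  then show conv: "convergent_prod (\<lambda>i. 1 - a * q ^ i)"
    by (intro abs_convergent_prod_imp_convergent_prod)
      (simp add: abs_convergent_prod_conv_summable)
  have "(\<lambda>n. qpoch a q (Suc n)) \<longlonglongrightarrow> qpoch_inf a q"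
    using convergent_prod_LIMSEQ[OF conv]
    by (simp add: qpoch_def qpoch_inf_def lessThan_Suc_atMost)
  then show "qpoch a q \<longlonglongrightarrow> qpoch_inf a q"
    by (simp only: filterlim_sequentially_Suc)
qed

lemma qpoch_Suc_shift: "qpoch a q (Suc n) = (1 - a) * qpoch (q * a) q n"
  unfolding qpoch_def by (subst prod.lessThan_Suc_shift) (simp add: mult_ac)

lemma qpoch_inf_shift:
  assumes "0 < q" "q < 1"
  shows "qpoch_inf a q = (1 - a) * qpoch_inf (q * a) q"
proof -
  have "(\<lambda>n. qpoch a q (Suc n)) \<longlonglongrightarrow> qpoch_inf a q"
    using qpoch_tendsto_qpoch_inf(1)[OF assms] by (simp only: filterlim_sequentially_Suc)
  moreover have "(\<lambda>n. qpoch a q (Suc n)) \<longlonglongrightarrow> (1 - a) * qpoch_inf (q * a) q"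
    unfolding qpoch_Suc_shift
    by (intro tendsto_intros qpoch_tendsto_qpoch_inf(1)[OF assms])
  ultimately show ?thesis
    using LIMSEQ_unique by blast
qed

lemma qpoch_pos:
  assumes "0 < q" "q < 1" "a < 1"
  shows "0 < qpoch a q n"
proof -
  have "a * q ^ i < 1" for i
  proof (cases "0 \<le> a")
    case True
    then have "a * q ^ i \<le> a * 1"
      using assms by (intro mult_left_mono power_le_one) auto
    then show ?thesis using assms by simp
  next
    case False
    then have "a * q ^ i \<le> 0"
      using assms by (simp add: mult_le_0_iff)
    then show ?thesis by simp
  qed
  then show ?thesis
    unfolding qpoch_def by (intro prod_pos) simp
qed

lemma qpoch_inf_pos:
  assumes "0 < q" "q < 1" "a < 1"
  shows "0 < qpoch_inf a q"
proof -
  have "1 - a * q ^ i \<noteq> 0" for i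
    using qpoch_pos[OF assms, of "Suc i"] by (auto simp: qpoch_def)
  then have "qpoch_inf a q \<noteq> 0"
    unfolding qpoch_inf_def by (intro prodinf_nonzero qpoch_tendsto_qpoch_inf assms)
  moreover have "0 \<le> qpoch_inf a q"
    using qpoch_pos[OF assms]
    by (intro LIMSEQ_le_const[OF qpoch_tendsto_qpoch_inf(1)[OF assms(1,2)]])
      (auto intro: less_imp_le)
  ultimately show ?thesis by simp
qed

text \<open>
  Euler's identity \<open>(q;q\<^sup>2)\<^sub>\<infinity> (-q;q)\<^sub>\<infinity> = 1\<close>, as a limit: splitting \<open>(q;q)\<^sub>2\<^sub>k\<close> into its
  factors of odd and even index, and then \<open>1 - q\<^sup>2\<^sup>i = (1 - q\<^sup>i) (1 + q\<^sup>i)\<close>, shows that the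
  partial products below are \<open>(q;q)\<^sub>2\<^sub>k / (q;q)\<^sub>k\<close>, a quotient of two sequences with the same
  nonzero limit.
\<close>

lemma euler_odd_product:
  assumes "0 < q" "q < 1"
  shows "(\<lambda>k. qpoch q (q\<^sup>2) k * qpoch (- q) q k) \<longlonglongrightarrow> 1"
proof -
  have split: "qpoch q q (2 * k) = qpoch q (q\<^sup>2) k * qpoch (- q) q k * qpoch q q k" for k
  proof (induction k)
    case (Suc k)
    have sq: "q ^ Suc (2 * k) = q * (q ^ k * q ^ k)" "q ^ (2 * k) = q ^ k * q ^ k"
      "(q\<^sup>2) ^ k = q ^ k * q ^ k"
      by (simp_all add: mult_2 power_add power2_eq_square power_mult_distrib)
    have "(1 - q * q ^ (2 * k)) * (1 - q * q ^ Suc (2 * k))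
        = (1 - q * (q\<^sup>2) ^ k) * (1 - - q * q ^ k) * (1 - q * q ^ k)"
      unfolding sq by (simp add: algebra_simps)
    with Suc show ?case by (simp add: qpoch_def mult_ac)
  qed (simp add: qpoch_def)
  have lim: "qpoch q q \<longlonglongrightarrow> qpoch_inf q q" and pos: "0 < qpoch_inf q q"
    using assms by (auto intro: qpoch_tendsto_qpoch_inf qpoch_inf_pos)
  have "(\<lambda>k. qpoch q q (2 * k)) \<longlonglongrightarrow> qpoch_inf q q"
    using LIMSEQ_subseq_LIMSEQ[OF lim, of "\<lambda>k. 2 * k"] by (simp add: strict_mono_def o_def)
  from tendsto_divide[OF this lim] pos
  have "(\<lambda>k. qpoch q q (2 * k) / qpoch q q k) \<longlonglongrightarrow> 1" by simp
  then show ?thesis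
    using qpoch_pos[OF assms, of q] assms
    by (simp add: split order_less_imp_not_eq2)
qed

section \<open>The \<open>q\<close>-derivative of a polynomial\<close>

text \<open>
  The division is exact, because the numerator vanishes at \<open>0\<close>. Working with this polynomial
  avoids the separate value that \<^const>\<open>qderiv\<close> takes at \<open>0\<close>.
\<close>

definition qderiv_poly :: "real \<Rightarrow> real poly \<Rightarrow> real poly" where
  "qderiv_poly q p = (pcompose p [:0, q:] - p) div [:0, q - 1:]"

lemma poly_qderiv_poly:
  assumes "q \<noteq> 1"
  shows "(q - 1) * x * poly (qderiv_poly q p) x = poly p (q * x) - poly p x"
proof -
  have "[:0, 1:] dvd pcompose p [:0, q:] - p"
    by (subst dvd_iff_poly_eq_0) (simp add: poly_pcompose)
  then have "smult (q - 1) [:0, 1:] dvd pcompose p [:0, q:] - p"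
    using assms by (subst smult_dvd_iff) auto
  then have "[:0, q - 1:] dvd pcompose p [:0, q:] - p"
    by simp
  then have "[:0, q - 1:] * qderiv_poly q p = pcompose p [:0, q:] - p"
    unfolding qderiv_poly_def by (rule dvd_mult_div_cancel)
  from arg_cong[OF this, of "\<lambda>p. poly p x"] show ?thesis
    by (simp add: poly_pcompose mult_ac)
qed

lemma qderiv_poly_eqI:
  assumes "q \<noteq> 1" "\<And>x. (q - 1) * x * poly d x = poly p (q * x) - poly p x"
  shows "qderiv_poly q p = d"
proof -
  have "poly ([:0, q - 1:] * d) = poly (pcompose p [:0, q:] - p)"
    using assms(2) by (auto simp: poly_pcompose fun_eq_iff mult_ac)
  then have "[:0, q - 1:] * d = pcompose p [:0, q:] - p"
    by (simp only: poly_eq_poly_eq_iff)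
  moreover have "[:0, q - 1:] * d div [:0, q - 1:] = d"
    using assms(1) by (intro nonzero_mult_div_cancel_left) simp
  ultimately show ?thesis by (simp add: qderiv_poly_def)
qed

lemma qderiv_poly_0:
  assumes "q \<noteq> 1"
  shows "qderiv_poly q 0 = 0"
  by (intro qderiv_poly_eqI assms) simp

lemma qderiv_poly_add:
  assumes "q \<noteq> 1"
  shows "qderiv_poly q (p + r) = qderiv_poly q p + qderiv_poly q r"
  using assms poly_qderiv_poly[OF assms, of _ p] poly_qderiv_poly[OF assms, of _ r]
  by (intro qderiv_poly_eqI) (simp_all add: distrib_left)

lemma qderiv_poly_smult:
  assumes "q \<noteq> 1"
  shows "qderiv_poly q (smult c p) = smult c (qderiv_poly q p)"
  using assms poly_qderiv_poly[OF assms, of _ p]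
  by (intro qderiv_poly_eqI) (simp_all add: mult.left_commute[of _ c] right_diff_distrib)

lemma qderiv_poly_diff:
  assumes "q \<noteq> 1"
  shows "qderiv_poly q (p - r) = qderiv_poly q p - qderiv_poly q r"
  using assms poly_qderiv_poly[OF assms, of _ p] poly_qderiv_poly[OF assms, of _ r]
  by (intro qderiv_poly_eqI) (simp_all add: right_diff_distrib)

lemma qderiv_poly_sum:
  assumes "q \<noteq> 1"
  shows "qderiv_poly q (\<Sum>i\<in>I. f i) = (\<Sum>i\<in>I. qderiv_poly q (f i))"
  by (induction I rule: infinite_finite_induct)
    (simp_all add: qderiv_poly_0 qderiv_poly_add assms)

lemma qderiv_poly_X_mult:
  assumes "q \<noteq> 1"
  shows "qderiv_poly q ([:0, 1:] * p) = p + smult q ([:0, 1:] * qderiv_poly q p)"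
proof (intro qderiv_poly_eqI assms)
  fix x
  have "(q - 1) * x * poly (p + smult q ([:0, 1:] * qderiv_poly q p)) x
      = (q - 1) * x * poly p x + q * x * ((q - 1) * x * poly (qderiv_poly q p) x)"
    by (simp add: algebra_simps)
  also have "\<dots> = poly ([:0, 1:] * p) (q * x) - poly ([:0, 1:] * p) x"
    by (subst poly_qderiv_poly[OF assms]) (simp add: algebra_simps)
  finally show "(q - 1) * x * poly (p + smult q ([:0, 1:] * qderiv_poly q p)) x
      = poly ([:0, 1:] * p) (q * x) - poly ([:0, 1:] * p) x" .
qed

text \<open>
  A polynomial invariant under \<open>x \<mapsto> q x\<close> has \<open>q\<^sup>i c\<^sub>i = c\<^sub>i\<close> for every coefficient \<open>c\<^sub>i\<close>.
\<close>

lemma qderiv_poly_eq_0_imp_const: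
  assumes "0 < q" "q < 1" "qderiv_poly q p = 0"
  shows "p = [:coeff p 0:]"
proof -
  have "poly (pcompose p [:0, q:]) = poly p"
    using poly_qderiv_poly[of q _ p] assms by (auto simp: poly_pcompose fun_eq_iff mult_ac)
  then have "pcompose p [:0, q:] = p"
    by (simp only: poly_eq_poly_eq_iff)
  then have "q ^ i * coeff p i = coeff p i" for i
    by (metis coeff_pcompose_linear)
  moreover have "q ^ Suc i < 1" for i
    using assms by (intro power_Suc_less_one) auto
  ultimately have "coeff p (Suc i) = 0" for i
    by (metis mult_cancel_right1 less_irrefl)
  then show ?thesis
    by (intro poly_eqI) (simp add: coeff_pCons split: nat.split)
qed

text \<open>
  At \<open>0\<close>, where \<^const>\<open>qderiv\<close> is the ordinary derivative, the two sides agree because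
  differentiating \<open>(q - 1) x d(x) = p(q x) - p(x)\<close> there gives \<open>(q - 1) d(0) = (q - 1) p'(0)\<close>.
\<close>

lemma qderiv_poly:
  assumes "q \<noteq> 1"
  shows "qderiv q (poly p) = poly (qderiv_poly q p)"
proof
  fix x
  show "qderiv q (poly p) x = poly (qderiv_poly q p) x"
  proof (cases "x = 0")
    case True
    have "poly ([:0, q - 1:] * qderiv_poly q p) = poly (pcompose p [:0, q:] - p)"
      using poly_qderiv_poly[OF assms, of _ p] by (auto simp: poly_pcompose fun_eq_iff mult_ac)
    then have "[:0, q - 1:] * qderiv_poly q p = pcompose p [:0, q:] - p"
      by (simp only: poly_eq_poly_eq_iff)
    from arg_cong[OF this, of "\<lambda>p. poly (pderiv p) 0"]
    have "(q - 1) * poly (qderiv_poly q p) 0 = (q - 1) * poly (pderiv p) 0"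
      by (simp add: pderiv_mult pderiv_pCons pderiv_diff pderiv_pcompose poly_pcompose algebra_simps)
    then have "poly (qderiv_poly q p) 0 = poly (pderiv p) 0"
      using assms by simp
    moreover have "deriv (poly p) 0 = poly (pderiv p) 0"
      by (intro DERIV_imp_deriv poly_DERIV)
    ultimately show ?thesis
      using True by (simp add: qderiv_def)
  next
    case False
    then show ?thesis
      using poly_qderiv_poly[OF assms, of x p] assms by (simp add: qderiv_def field_simps)
  qed
qed

lemma funpow_qderiv_poly:
  assumes "q \<noteq> 1"
  shows "(qderiv q ^^ j) (poly p) = poly ((qderiv_poly q ^^ j) p)"
  by (induction j) (simp_all add: qderiv_poly[OF assms])

lemma funpow_qderiv_poly_linear:
  assumes "q \<noteq> 1"
  shows "(qderiv_poly q ^^ j) (p - r) = (qderiv_poly q ^^ j) p - (qderiv_poly q ^^ j) r"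
    and "(qderiv_poly q ^^ j) (smult c p) = smult c ((qderiv_poly q ^^ j) p)"
    and "(qderiv_poly q ^^ j) (\<Sum>i\<in>I. f i) = (\<Sum>i\<in>I. (qderiv_poly q ^^ j) (f i))"
  by (induction j)
    (simp_all add: qderiv_poly_diff qderiv_poly_smult qderiv_poly_sum assms)

section \<open>The \<open>q\<close>-Hermite I polynomials\<close>

lemma smult_sum_right: "smult (a::'a::comm_semiring_0) (\<Sum>i\<in>I. f i) = (\<Sum>i\<in>I. smult a (f i))"
  by (induction I rule: infinite_finite_induct) (simp_all add: smult_add_right)

lemma qHermite_neg: "m < 0 \<Longrightarrow> qHermite q m = 0"
  by (simp add: qHermite_def)

lemma qHermite_0: "qHermite q 0 = 1"
  by (simp add: qHermite_def qpoch_def binomial_eq_0)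

text \<open>
  The product \<open>(x - 1) (x - q) \<dots> (x - q\<^sup>k\<^sup>-\<^sup>1)\<close> is to the \<open>q\<close>-derivative what \<open>x\<^sup>k\<close> is to the
  ordinary one.
\<close>

lemma qderiv_poly_shifted_power:
  assumes "q \<noteq> 1" "q \<noteq> 0"
  shows "qderiv_poly q (\<Prod>i<Suc k. [:- (q ^ i), 1:]) =
    smult ((1 - q ^ Suc k) / (1 - q)) (\<Prod>i<k. [:- (q ^ i), 1:])"
proof (intro qderiv_poly_eqI assms)
  fix x :: real
  define P where "P = (\<Prod>i<k. x - q ^ i)"
  have scaled: "(\<Prod>i<Suc k. q * x - q ^ i) = (q * x - 1) * (q ^ k * P)"
  proof -
    have "(\<Prod>i<Suc k. q * x - q ^ i) = (q * x - 1) * (\<Prod>i<k. q * (x - q ^ i))"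
      by (subst prod.lessThan_Suc_shift) (simp add: right_diff_distrib)
    then show ?thesis by (simp add: P_def prod.distrib)
  qed
  have "(q - 1) * x * ((1 - q ^ Suc k) / (1 - q) * P) = (q ^ Suc k - 1) * x * P"
    using assms by (simp add: field_simps)
  also have "\<dots> = (q * x - 1) * (q ^ k * P) - P * (x - q ^ k)"
    by (simp add: algebra_simps)
  finally show "(q - 1) * x * poly (smult ((1 - q ^ Suc k) / (1 - q)) (\<Prod>i<k. [:- (q ^ i), 1:])) x
      = poly (\<Prod>i<Suc k. [:- (q ^ i), 1:]) (q * x) - poly (\<Prod>i<Suc k. [:- (q ^ i), 1:]) x"
    unfolding poly_prod poly_smult using scaled by (simp add: P_def add.commute)
qed

lemma qderiv_poly_qHermite_Suc:
  assumes "0 < q" "q < 1"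
  shows "qderiv_poly q (qHermite q (int (Suc n))) =
    smult ((1 - q ^ Suc n) / (1 - q)) (qHermite q (int n))"
proof -
  define c where "c n k = q ^ (n choose 2) * (qpoch (q powi (- int n)) q k / qpoch q q k * (- q) ^ k)"
    for n k
  define \<phi> where "\<phi> k = (\<Prod>i<k. [:- (q ^ i), 1:])" for k
  have H: "qHermite q (int n) = (\<Sum>k\<le>n. smult (c n k) (\<phi> k))" for n
    by (simp add: qHermite_def c_def \<phi>_def smult_sum_right)
  have q1: "q \<noteq> 1" and q0: "q \<noteq> 0" using assms by auto
  \<comment> \<open>Since \<open>D\<^sub>q \<phi>\<^sub>k\<^sub>+\<^sub>1 = [k+1]\<^sub>q \<phi>\<^sub>k\<close>, the claim reduces to this identity between coefficients.\<close>
  have coeff: "c (Suc n) (Suc k) * ((1 - q ^ Suc k) / (1 - q)) = (1 - q ^ Suc n) / (1 - q) * c n k" for k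
  proof -
    have a: "q * q powi (- int (Suc n)) = q powi (- int n)"
      using assms by (simp add: power_int_diff power_int_minus inverse_eq_divide)
    have b: "qpoch (q powi (- int (Suc n))) q (Suc k)
        = (1 - q powi (- int (Suc n))) * qpoch (q powi (- int n)) q k"
      by (simp only: qpoch_Suc_shift a)
    have d: "qpoch q q (Suc k) = qpoch q q k * (1 - q ^ Suc k)"
      by (simp add: qpoch_def)
    have e: "q ^ (Suc n choose 2) = q ^ (n choose 2) * q ^ n"
      by (simp add: numeral_2_eq_2 power_add)
    have f: "q ^ n * (1 - q powi (- int (Suc n))) * (- q) = 1 - q ^ Suc n"
      using assms by (simp add: power_int_minus power_int_diff field_simps)
    have nz: "1 - q ^ Suc k \<noteq> 0"
      using assms power_Suc_less_one[of q k] by auto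
    have cancel: "E * N * (W * Q / (P * u) * (- q * X)) * (u / d) = N * W * (- q) / d * (E * (Q / P * X))"
      if "u \<noteq> 0" for E N W Q P u X d :: real
      using that by (simp add: mult_ac)
    have "c (Suc n) (Suc k) * ((1 - q ^ Suc k) / (1 - q))
       = (q ^ n * (1 - q powi (- int (Suc n))) * (- q)) / (1 - q) *
         (q ^ (n choose 2) * (qpoch (q powi (- int n)) q k / qpoch q q k * (- q) ^ k))"
      unfolding c_def b d e power_Suc[of "- q"] by (rule cancel) (rule nz)
    then show ?thesis by (simp only: f c_def)
  qed
  have "qderiv_poly q (\<phi> 0) = 0"
    unfolding \<phi>_def using q1 by (intro qderiv_poly_eqI) auto
  then have "qderiv_poly q (qHermite q (int (Suc n)))
      = (\<Sum>k\<le>n. smult (c (Suc n) (Suc k)) (qderiv_poly q (\<phi> (Suc k))))"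
    unfolding H qderiv_poly_sum[OF q1] qderiv_poly_smult[OF q1]
    by (subst sum.atMost_Suc_shift) simp
  also have "\<dots> = (\<Sum>k\<le>n. smult ((1 - q ^ Suc n) / (1 - q)) (smult (c n k) (\<phi> k)))"
    unfolding \<phi>_def
    by (intro sum.cong refl) (simp only: qderiv_poly_shifted_power[OF q1 q0] smult_smult coeff)
  finally show ?thesis
    by (simp only: H smult_sum_right)
qed

lemma qderiv_poly_qHermite:
  assumes "0 < q" "q < 1"
  shows "qderiv_poly q (qHermite q m) = smult ((1 - q powi m) / (1 - q)) (qHermite q (m - 1))"
proof (cases "m \<le> 0")
  case True
  have "qderiv_poly q 1 = 0"
    using assms by (intro qderiv_poly_eqI) auto
  then show ?thesis
    using True assms by (cases "m = 0") (auto simp: qHermite_0 qHermite_neg qderiv_poly_0)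
next
  case False
  then have "m = int (Suc (nat (m - 1)))" by simp
  then show ?thesis
    using qderiv_poly_qHermite_Suc[OF assms, of "nat (m - 1)"]
    by (metis False add_diff_cancel_left' int_nat_eq of_nat_Suc power_int_of_nat zle_diff1_eq linorder_not_less)
qed

text \<open>
  Differentiating \<open>j\<close> times produces the factors \<open>[n]\<^sub>q, \<dots>, [n - j + 1]\<^sub>q\<close>, whose product is the
  falling factorial. The rule \<open>D\<^sub>q H\<^sub>m = [m]\<^sub>q H\<^sub>m\<^sub>-\<^sub>1\<close> for all integers \<open>m\<close> makes the case \<open>j > n\<close>
  no exception.
\<close>

lemma funpow_qderiv_poly_qHermite:
  assumes "0 < q" "q < 1"
  shows "(qderiv_poly q ^^ j) (qHermite q (int n)) =
    smult (qfalling q n j) (qHermite q (int n - int j))"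
proof (induction j)
  case 0
  then show ?case by (simp add: qfalling_def qpoch_def binomial_eq_0)
next
  case (Suc j)
  have "qfalling q n (Suc j) = qfalling q n j * ((1 - q powi (int n - int j)) / (1 - q))"
  proof -
    have e: "int (Suc j) * int n - int (Suc j choose 2)
        = (int j * int n - int (j choose 2)) + (int n - int j)"
      by (simp add: numeral_2_eq_2 algebra_simps)
    have "(1 - q powi (- int n) * q ^ j) * q powi (int n - int j) = - (1 - q powi (int n - int j))"
      using assms by (simp add: power_int_diff power_int_minus field_simps)
    moreover have "qpoch (q powi - int n) q (Suc j)
        = qpoch (q powi - int n) q j * (1 - q powi (- int n) * q ^ j)"
      by (simp add: qpoch_def)
    ultimately have "qfalling q n (Suc j)
        = qpoch (q powi - int n) q j * q powi (int j * int n - int (j choose 2)) *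
          (- (1 - q powi (int n - int j))) / ((q - 1) ^ j * (q - 1))"
      unfolding qfalling_def e using assms by (simp add: power_int_add mult_ac)
    then show ?thesis
      using assms unfolding qfalling_def by (simp add: divide_simps) (simp add: algebra_simps)
  qed
  then show ?case
    using assms Suc by (simp add: qderiv_poly_smult qderiv_poly_qHermite algebra_simps)
qed

text \<open>At \<open>x = 1\<close> only the first term of the hypergeometric sum survives.\<close>

lemma poly_qHermite_1: "poly (qHermite q (int n)) 1 = q ^ (n choose 2)"
proof -
  define a where "a k = qpoch (q powi (- int n)) q k / qpoch q q k * (- q) ^ k" for k
  have 1: "poly (\<Prod>i<k. [:- (q ^ i), 1:]) 1 = (if k = 0 then 1 else 0)" for k
    by (cases k) (simp_all add: poly_prod prod.lessThan_Suc_shift del: prod.lessThan_Suc)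
  have "qHermite q (int n) =
      smult (q ^ (n choose 2)) (\<Sum>k\<le>n. smult (a k) (\<Prod>i<k. [:- (q ^ i), 1:]))"
    by (simp add: qHermite_def a_def)
  then have "poly (qHermite q (int n)) 1 = q ^ (n choose 2) * (\<Sum>k\<le>n. if k = 0 then a k else 0)"
    by (simp only: poly_smult poly_sum 1) (simp add: if_distrib cong: if_cong)
  then show ?thesis
    by (simp add: a_def qpoch_def)
qed

text \<open>
  Let \<open>R\<^sub>n\<close> be the difference of the two sides. The rule for the derivative of \<open>H\<^sub>n\<close> gives
  \<open>D\<^sub>q R\<^sub>n\<^sub>+\<^sub>1 = q [n+1]\<^sub>q R\<^sub>n\<close>, so \<open>R\<^sub>n\<^sub>+\<^sub>1\<close> is constant if \<open>R\<^sub>n\<close> is zero; the constant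
  is its value at \<open>x = 1\<close>, which the known values \<open>H\<^sub>n(1)\<close> show to be zero. For \<open>n = 0\<close> the factor \<open>1 - q\<^sup>n\<close> is zero, so the truncated exponent
  \<open>n - 1\<close> is harmless.
\<close>

lemma qHermite_recurrence:
  assumes "0 < q" "q < 1"
  shows "[:0, 1:] * qHermite q (int n) =
    qHermite q (int n + 1) + smult (q ^ (n - 1) * (1 - q ^ n)) (qHermite q (int n - 1))"
proof -
  have q1: "q \<noteq> 1" using assms by simp
  define \<gamma> where "\<gamma> n = q ^ (n - 1) * (1 - q ^ n)" for n
  define R where "R n = [:0, 1:] * qHermite q (int n)
    - (qHermite q (int n + 1) + smult (\<gamma> n) (qHermite q (int n - 1)))" for n
  have const: "qderiv_poly q (R n) = 0 \<Longrightarrow> R n = 0" for n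
  proof -
    assume "qderiv_poly q (R n) = 0"
    then have c: "R n = [:coeff (R n) 0:]"
      by (rule qderiv_poly_eq_0_imp_const[OF assms])
    have "poly (R n) 1 = 0"
    proof (cases n)
      case 0
      then show ?thesis
        using poly_qHermite_1[of q 1] by (simp add: R_def qHermite_0 qHermite_neg binomial_eq_0)
    next
      case (Suc k)
      then show ?thesis
        using poly_qHermite_1[of q k] poly_qHermite_1[of q "Suc k"]
          poly_qHermite_1[of q "Suc (Suc k)"]
        by (simp add: R_def \<gamma>_def numeral_2_eq_2 power_add algebra_simps)
    qed
    with c show "R n = 0"
      by (metis mult_zero_right add.right_neutral pCons_0_0 poly_0 poly_pCons)
  qed
  have "R n = 0"
  proof (induction n)
    case 0
    have "R 0 = [:0, 1:] - qHermite q 1"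
      by (simp add: R_def \<gamma>_def qHermite_0)
    moreover have "qderiv_poly q [:0, 1:] = 1"
      using assms by (intro qderiv_poly_eqI) (auto simp: algebra_simps)
    moreover have "qderiv_poly q (qHermite q 1) = 1"
      using qderiv_poly_qHermite[OF assms, of 1] assms by (simp add: qHermite_0)
    ultimately show ?case
      using assms by (intro const) (simp add: qderiv_poly_diff)
  next
    case (Suc n)
    define b where "b m = (1 - q ^ m) / (1 - q)" for m :: nat
    have g: "\<gamma> (Suc n) * b n = q * b (Suc n) * \<gamma> n"
      by (cases n) (simp_all add: \<gamma>_def b_def)
    have b2: "b (Suc (Suc n)) = 1 + q * b (Suc n)"
      using assms by (simp add: b_def divide_simps) (simp add: algebra_simps)
    have "qderiv_poly q (R (Suc n)) = smult (q * b (Suc n)) (R n)"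
    proof -
      have D: "qderiv_poly q (qHermite q (int n + 1)) = smult (b (Suc n)) (qHermite q (int n))"
        "qderiv_poly q (qHermite q (int n + 2)) = smult (b (Suc (Suc n))) (qHermite q (int n + 1))"
        "qderiv_poly q (qHermite q (int n)) = smult (b n) (qHermite q (int n - 1))"
        using qderiv_poly_qHermite[OF assms, of "int (Suc n)"]
          qderiv_poly_qHermite[OF assms, of "int (Suc (Suc n))"]
          qderiv_poly_qHermite[OF assms, of "int n"]
        unfolding b_def power_int_of_nat by (simp_all add: add.commute)
      have idx: "int (Suc n) = int n + 1" "int n + 1 + 1 = int n + 2" "int n + 1 - 1 = int n"
        by simp_all
      have "qderiv_poly q (R (Suc n)) =
          qHermite q (int n + 1) + smult q ([:0, 1:] * smult (b (Suc n)) (qHermite q (int n)))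
          - (smult (b (Suc (Suc n))) (qHermite q (int n + 1))
             + smult (\<gamma> (Suc n)) (smult (b n) (qHermite q (int n - 1))))"
        unfolding R_def idx
        by (simp only: qderiv_poly_add[OF q1] qderiv_poly_diff[OF q1] qderiv_poly_smult[OF q1]
            qderiv_poly_X_mult[OF q1] D)
      also have "\<dots> = smult (q * b (Suc n)) (R n)"
      proof (rule poly_eq_poly_eq_iff[THEN iffD1], rule ext)
        fix x
        let ?h = "\<lambda>m. poly (qHermite q m) x"
        have "?h (int n + 1) + q * (x * (b (Suc n) * ?h (int n)))
            - (b (Suc (Suc n)) * ?h (int n + 1) + \<gamma> (Suc n) * b n * ?h (int n - 1))
          = q * b (Suc n) * (x * ?h (int n) - (?h (int n + 1) + \<gamma> n * ?h (int n - 1)))"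
          unfolding g b2 by (simp only: algebra_simps)
        then show "poly (qHermite q (int n + 1)
            + smult q ([:0, 1:] * smult (b (Suc n)) (qHermite q (int n)))
            - (smult (b (Suc (Suc n))) (qHermite q (int n + 1))
               + smult (\<gamma> (Suc n)) (smult (b n) (qHermite q (int n - 1))))) x
          = poly (smult (q * b (Suc n)) (R n)) x"
          by (simp add: R_def mult_ac)
      qed
      finally show ?thesis .
    qed
    with Suc show ?case by (intro const) simp
  qed
  then show ?thesis by (simp add: R_def \<gamma>_def)
qed

lemma qHermite_monic:
  assumes "0 < q" "q < 1"
  shows "degree (qHermite q (int n)) = n \<and> lead_coeff (qHermite q (int n)) = 1"
proof (induction n rule: less_induct)
  case (less n)
  show ?case
  proof (cases n)
    case 0
    then show ?thesis by (simp add: qHermite_0)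
  next
    case (Suc k)
    define H where "H = qHermite q (int k)"
    define r where "r = smult (q ^ (k - 1) * (1 - q ^ k)) (qHermite q (int k - 1))"
    have H: "degree H = k" "lead_coeff H = 1"
      using less[of k] Suc by (auto simp: H_def)
    have "degree (pCons 0 H) = Suc k" using H by auto
    have r: "degree r < Suc k"
    proof (cases k)
      case 0
      then show ?thesis by (simp add: r_def)
    next
      case (Suc l)
      then show ?thesis
        using less[of l] \<open>n = Suc k\<close> degree_smult_le[of _ "qHermite q (int l)"]
        unfolding r_def by (auto intro: le_less_trans)
    qed
    have "qHermite q (int n) = pCons 0 H - r"
      using qHermite_recurrence[OF assms, of k] Suc by (simp add: H_def r_def algebra_simps)
    then show ?thesis
      using Suc H r \<open>degree (pCons 0 H) = Suc k\<close> coeff_eq_0[OF r]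
        degree_add_eq_left[of "- r" "pCons 0 H"]
      by simp
  qed
qed

section \<open>The orthogonality functional\<close>

definition qHermite_weight :: "real \<Rightarrow> real \<Rightarrow> real" where
  "qHermite_weight q x = qpoch_inf (q * x) q * qpoch_inf (- (q * x)) q"

lemma qHermite_weight_minus: "qHermite_weight q (- x) = qHermite_weight q x"
  by (simp add: qHermite_weight_def)

lemma qHermite_weight_bounds:
  assumes "0 < q" "q < 1" "\<bar>x\<bar> \<le> 1"
  shows "0 \<le> qHermite_weight q x" and "qHermite_weight q x \<le> 1"
proof -
  have lim: "(\<lambda>n. qpoch (q * x) q n * qpoch (- (q * x)) q n) \<longlonglongrightarrow> qHermite_weight q x"
    unfolding qHermite_weight_def
    by (intro tendsto_mult qpoch_tendsto_qpoch_inf assms)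
  have prod: "qpoch (q * x) q n * qpoch (- (q * x)) q n = (\<Prod>i<n. 1 - (q * x * q ^ i)\<^sup>2)" for n
    unfolding qpoch_def prod.distrib[symmetric]
    by (simp add: power2_eq_square algebra_simps)
  have "\<bar>q * x * q ^ i\<bar> \<le> 1" for i
    using assms by (simp add: abs_mult mult_le_one power_le_one)
  then have "(q * x * q ^ i)\<^sup>2 \<le> 1" for i
    by (simp only: abs_square_le_1)
  then have "0 \<le> qpoch (q * x) q n * qpoch (- (q * x)) q n"
    "qpoch (q * x) q n * qpoch (- (q * x)) q n \<le> 1" for n
    unfolding prod by (auto intro!: prod_nonneg prod_le_1)
  with lim show "0 \<le> qHermite_weight q x" "qHermite_weight q x \<le> 1"
    by (auto intro: LIMSEQ_le_const LIMSEQ_le_const2)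
qed

lemma qHermite_weight_shift:
  assumes "0 < q" "q < 1"
  shows "qHermite_weight q x = (1 - (q * x)\<^sup>2) * qHermite_weight q (q * x)"
  unfolding qHermite_weight_def
  unfolding qpoch_inf_shift[OF assms, of "q * x"] qpoch_inf_shift[OF assms, of "- (q * x)"]
  by (simp add: power2_eq_square algebra_simps)

definition qHermite_functional :: "real \<Rightarrow> real poly \<Rightarrow> real" where
  "qHermite_functional q p = jackson_integral q (\<lambda>x. poly p x * qHermite_weight q x)"

definition jackson_term :: "real \<Rightarrow> real poly \<Rightarrow> nat \<Rightarrow> real" where
  "jackson_term q p m = q ^ m * (poly p (q ^ m) + poly p (- (q ^ m))) * qHermite_weight q (q ^ m)"

lemma qHermite_functional_eq: "qHermite_functional q p = (1 - q) * (\<Sum>m. jackson_term q p m)"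
  unfolding qHermite_functional_def jackson_integral_def jackson_term_def
  by (simp add: qHermite_weight_minus algebra_simps)

lemma summable_jackson_term:
  assumes "0 < q" "q < 1"
  shows "summable (jackson_term q p)"
proof -
  have "compact (poly p ` {-1..1})"
    by (intro compact_continuous_image continuous_intros) auto
  then obtain B where B: "\<And>x. \<bar>x\<bar> \<le> 1 \<Longrightarrow> \<bar>poly p x\<bar> \<le> B"
    unfolding abs_le_iff[of _ 1]
    by (metis (no_types, lifting) bounded_iff compact_imp_bounded atLeastAtMost_iff imageI
        real_norm_def minus_le_iff)
  have "norm (jackson_term q p m) \<le> 2 * B * q ^ m" for m
  proof -
    have x: "\<bar>q ^ m\<bar> \<le> 1" using assms by (simp add: power_le_one)
    have "\<bar>poly p (q ^ m) + poly p (- (q ^ m))\<bar> \<le> 2 * B"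
      using B[of "q ^ m"] B[of "- (q ^ m)"] x by linarith
    then have "\<bar>poly p (q ^ m) + poly p (- (q ^ m))\<bar> * \<bar>qHermite_weight q (q ^ m)\<bar> \<le> 2 * B * 1"
      using qHermite_weight_bounds[OF assms x] by (intro mult_mono) auto
    then have "q ^ m * (\<bar>poly p (q ^ m) + poly p (- (q ^ m))\<bar> * \<bar>qHermite_weight q (q ^ m)\<bar>)
        \<le> q ^ m * (2 * B * 1)"
      using assms by (intro mult_left_mono) auto
    then show ?thesis
      using assms by (simp add: jackson_term_def abs_mult mult_ac)
  qed
  moreover have "summable (\<lambda>m. 2 * B * q ^ m)"
    using assms by (intro summable_mult summable_geometric) auto
  ultimately show ?thesis
    by (rule summable_comparison_test'[rotated])
qed

lemma qHermite_functional_linear: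
  assumes "0 < q" "q < 1"
  shows "qHermite_functional q (p + r) = qHermite_functional q p + qHermite_functional q r"
    and "qHermite_functional q (p - r) = qHermite_functional q p - qHermite_functional q r"
    and "qHermite_functional q (smult c p) = c * qHermite_functional q p"
    and "qHermite_functional q 0 = 0"
proof -
  note s = summable_jackson_term[OF assms]
  have t: "jackson_term q (p + r) = (\<lambda>m. jackson_term q p m + jackson_term q r m)"
    "jackson_term q (p - r) = (\<lambda>m. jackson_term q p m - jackson_term q r m)"
    "jackson_term q (smult c p) = (\<lambda>m. c * jackson_term q p m)"
    by (simp_all add: jackson_term_def fun_eq_iff algebra_simps)
  show "qHermite_functional q (p + r) = qHermite_functional q p + qHermite_functional q r"
    by (simp add: qHermite_functional_eq t suminf_add[OF s s, symmetric] distrib_left)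
  show "qHermite_functional q (p - r) = qHermite_functional q p - qHermite_functional q r"
    by (simp add: qHermite_functional_eq t suminf_diff[OF s s, symmetric] right_diff_distrib)
  show "qHermite_functional q (smult c p) = c * qHermite_functional q p"
    by (simp add: qHermite_functional_eq t suminf_mult[OF s])
  show "qHermite_functional q 0 = 0"
    by (simp add: qHermite_functional_eq jackson_term_def)
qed

lemma qHermite_functional_sum:
  assumes "0 < q" "q < 1"
  shows "qHermite_functional q (\<Sum>i\<in>I. f i) = (\<Sum>i\<in>I. qHermite_functional q (f i))"
  by (induction I rule: infinite_finite_induct)
    (simp_all add: qHermite_functional_linear assms)

text \<open>
  The weight solves a \<open>q\<close>-Pearson equation: \<open>v(x) = (1 - x\<^sup>2) w(x)\<close> satisfies \<open>v(q x) = w(x)\<close>.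
  Hence the \<open>q\<close>-difference of \<open>v(x) g(x)\<close> is \<open>w(x)\<close> times a combination of \<open>g(x)\<close> and
  \<open>g(q x)\<close>, and summing it along the lattice telescopes, with no boundary term since \<open>v\<close>
  vanishes at \<open>1\<close> and \<open>-1\<close> and the contributions at \<open>0\<close> from both sides cancel.
\<close>

lemma qHermite_functional_by_parts:
  assumes "0 < q" "q < 1"
  shows "qHermite_functional q ([:0, 1:] * g) = (1 - q) * qHermite_functional q (qderiv_poly q g)"
proof -
  define b where "b m = (1 - (q ^ m)\<^sup>2) * qHermite_weight q (q ^ m) * (poly g (q ^ m) - poly g (- (q ^ m)))"
    for m
  have "(\<lambda>m. q ^ m) \<longlonglongrightarrow> 0"
    using assms by (intro LIMSEQ_realpow_zero) auto
  then have "(\<lambda>m. poly g (q ^ m) - poly g (- (q ^ m))) \<longlonglongrightarrow> poly g 0 - poly g (- 0)"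
    by (intro tendsto_diff tendsto_poly tendsto_minus)
  then have g: "(\<lambda>m. poly g (q ^ m) - poly g (- (q ^ m))) \<longlonglongrightarrow> 0" by simp
  have "b \<longlonglongrightarrow> 0"
  proof (rule tendsto_0_le[OF g, of _ 1], intro always_eventually allI)
    fix m
    have x: "\<bar>q ^ m\<bar> \<le> 1" using assms by (simp add: power_le_one)
    then have "(q ^ m)\<^sup>2 \<le> 1" by (simp only: abs_square_le_1)
    then have "\<bar>(1 - (q ^ m)\<^sup>2) * qHermite_weight q (q ^ m)\<bar> \<le> 1"
      using qHermite_weight_bounds[OF assms x] unfolding abs_mult
      by (intro mult_le_one) auto
    then have "\<bar>(1 - (q ^ m)\<^sup>2) * qHermite_weight q (q ^ m)\<bar> * \<bar>poly g (q ^ m) - poly g (- (q ^ m))\<bar>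
        \<le> 1 * \<bar>poly g (q ^ m) - poly g (- (q ^ m))\<bar>"
      by (intro mult_right_mono) auto
    then show "norm (b m) \<le> norm (poly g (q ^ m) - poly g (- (q ^ m))) * 1"
      by (simp add: b_def abs_mult)
  qed
  then have "(\<lambda>m. b m - b (Suc m)) sums (b 0 - 0)"
    by (rule telescope_sums')
  moreover have "b 0 = 0" by (simp add: b_def)
  moreover have "b m - b (Suc m) = (1 - q) * jackson_term q (qderiv_poly q g) m
      - jackson_term q ([:0, 1:] * g) m" for m
  proof -
    define x where "x = q ^ m"
    have "b (Suc m) = qHermite_weight q x * (poly g (q * x) - poly g (- (q * x)))"
      using qHermite_weight_shift[OF assms, of x] by (simp add: b_def x_def)
    moreover have "(1 - q) * x * (poly (qderiv_poly q g) x + poly (qderiv_poly q g) (- x))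
      = (poly g x - poly g (q * x)) - (poly g (- x) - poly g (- (q * x)))"
      using poly_qderiv_poly[of q x g] poly_qderiv_poly[of q "- x" g] assms
      by (simp add: algebra_simps)
    then have "(1 - q) * jackson_term q (qderiv_poly q g) m =
        ((poly g x - poly g (q * x)) - (poly g (- x) - poly g (- (q * x)))) * qHermite_weight q x"
      by (simp add: jackson_term_def x_def[symmetric] mult.assoc[symmetric])
    ultimately show ?thesis
      by (simp add: b_def jackson_term_def x_def[symmetric] algebra_simps power2_eq_square)
  qed
  ultimately have "(\<lambda>m. (1 - q) * jackson_term q (qderiv_poly q g) m
      - jackson_term q ([:0, 1:] * g) m) sums 0"
    by simp
  moreover have "(\<lambda>m. (1 - q) * jackson_term q (qderiv_poly q g) m - jackson_term q ([:0, 1:] * g) m)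
      sums ((1 - q) * suminf (jackson_term q (qderiv_poly q g)) - suminf (jackson_term q ([:0, 1:] * g)))"
    by (intro sums_diff sums_mult summable_sums summable_jackson_term assms)
  ultimately have "(1 - q) * suminf (jackson_term q (qderiv_poly q g))
      = suminf (jackson_term q ([:0, 1:] * g))"
    using sums_unique2 by fastforce
  then show ?thesis by (simp only: qHermite_functional_eq)
qed

lemma qHermite_functional_even_moment:
  assumes "0 < q" "q < 1"
  shows "qHermite_functional q (monom 1 (2 * k)) = qpoch q (q\<^sup>2) k * qHermite_functional q 1"
proof (induction k)
  case (Suc k)
  have D: "qderiv_poly q (monom 1 (Suc n)) = smult ((1 - q ^ Suc n) / (1 - q)) (monom 1 n)" for n
    using assms
    by (intro qderiv_poly_eqI) (auto simp: poly_monom field_simps)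
  have "monom (1::real) (2 * Suc k) = [:0, 1:] * monom 1 (Suc (2 * k))"
    by (simp add: monom_Suc)
  then have "qHermite_functional q (monom 1 (2 * Suc k))
      = (1 - q ^ Suc (2 * k)) * qHermite_functional q (monom 1 (2 * k))"
    using assms
    by (simp only: qHermite_functional_by_parts[OF assms] D qHermite_functional_linear[OF assms]) simp
  with Suc show ?case
    by (simp add: qpoch_def power_mult)
qed (simp add: qpoch_def)

text \<open>
  On the lattice points other than \<open>1\<close> and \<open>-1\<close> the monomial \<open>x\<^sup>2\<^sup>k\<close> is at most \<open>q\<^sup>2\<^sup>k\<close>.
\<close>

lemma qHermite_functional_even_moment_tendsto:
  assumes "0 < q" "q < 1"
  shows "(\<lambda>k. qHermite_functional q (monom 1 (2 * k))) \<longlonglongrightarrow> (1 - q) * (2 * qHermite_weight q 1)"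
proof -
  define tail where "tail k = (\<Sum>m. jackson_term q (monom 1 (2 * k)) (Suc m))" for k
  have split: "qHermite_functional q (monom 1 (2 * k)) = (1 - q) * (2 * qHermite_weight q 1 + tail k)" for k
  proof -
    have "jackson_term q (monom 1 (2 * k)) 0 = 2 * qHermite_weight q 1"
      by (simp add: jackson_term_def poly_monom)
    then show ?thesis
      using suminf_split_head[OF summable_jackson_term[OF assms, of "monom 1 (2 * k)"]]
      by (simp add: qHermite_functional_eq tail_def)
  qed
  have geo: "(\<lambda>m. 2 * (q\<^sup>2) ^ k * q ^ m) sums (2 * (q\<^sup>2) ^ k * (1 / (1 - q)))" for k
    using assms by (intro sums_mult geometric_sums) auto
  have "norm (jackson_term q (monom 1 (2 * k)) (Suc m)) \<le> 2 * (q\<^sup>2) ^ k * q ^ m" for k m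
  proof -
    have x: "\<bar>q ^ Suc m\<bar> \<le> 1" using assms by (simp add: power_le_one mult_le_one)
    have "q ^ Suc m \<le> q * 1"
      unfolding power_Suc using assms by (intro mult_left_mono power_le_one) auto
    then have "(q ^ Suc m) ^ (2 * k) \<le> q ^ (2 * k)"
      using assms by (intro power_mono) auto
    moreover have "q ^ Suc m \<le> q ^ m"
      using assms by (intro power_decreasing) auto
    ultimately have "q ^ Suc m * (2 * (q ^ Suc m) ^ (2 * k)) * qHermite_weight q (q ^ Suc m)
        \<le> q ^ m * (2 * q ^ (2 * k)) * 1"
      using assms qHermite_weight_bounds[OF assms x] by (intro mult_mono) auto
    then show ?thesis
      using qHermite_weight_bounds[OF assms x] assms
      by (simp add: jackson_term_def poly_monom abs_mult power_mult[symmetric] mult_ac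
          del: power_Suc)
  qed
  then have bound: "norm (tail k) \<le> 2 * (q\<^sup>2) ^ k * (1 / (1 - q))" for k
    unfolding tail_def using geo[of k]
    by (metis (no_types, lifting) norm_suminf_le sums_iff)
  have "(\<lambda>k. (q\<^sup>2) ^ k) \<longlonglongrightarrow> 0"
    using assms by (intro LIMSEQ_realpow_zero) (auto simp: abs_square_less_1)
  then have "(\<lambda>k. 2 * (q\<^sup>2) ^ k * (1 / (1 - q))) \<longlonglongrightarrow> 2 * 0 * (1 / (1 - q))"
    by (intro tendsto_mult tendsto_const)
  then have "tail \<longlonglongrightarrow> 0"
    using bound by (intro Lim_null_comparison[where f = tail]) auto
  then have "(\<lambda>k. (1 - q) * (2 * qHermite_weight q 1 + tail k)) \<longlonglongrightarrow> (1 - q) * (2 * qHermite_weight q 1 + 0)"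
    by (intro tendsto_intros)
  then show ?thesis by (simp add: split)
qed

text \<open>
  The total mass is obtained by computing the limit of the moments of order \<open>2 k\<close> in two ways:
  only the two lattice points of modulus \<open>1\<close> contribute in the limit, while integration by
  parts gives these moments as \<open>(q;q\<^sup>2)\<^sub>k\<close> times the mass. Euler's identity removes the factor
  \<open>(q;q\<^sup>2)\<^sub>\<infinity>\<close>.
\<close>

lemma qHermite_functional_1:
  assumes "0 < q" "q < 1"
  shows "qHermite_functional q 1 = qHermite_norm2 q 0"
proof -
  have "(\<lambda>k. qHermite_functional q (monom 1 (2 * k)) * qpoch (- q) q k)
      \<longlonglongrightarrow> (1 - q) * (2 * qHermite_weight q 1) * qpoch_inf (- q) q"
    by (intro tendsto_mult qHermite_functional_even_moment_tendsto qpoch_tendsto_qpoch_inf assms)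
  moreover have "(\<lambda>k. qHermite_functional q 1 * (qpoch q (q\<^sup>2) k * qpoch (- q) q k))
      \<longlonglongrightarrow> qHermite_functional q 1 * 1"
    by (intro tendsto_mult_left euler_odd_product assms)
  then have "(\<lambda>k. qHermite_functional q (monom 1 (2 * k)) * qpoch (- q) q k)
      \<longlonglongrightarrow> qHermite_functional q 1"
    unfolding qHermite_functional_even_moment[OF assms] by (simp add: mult_ac)
  ultimately have "qHermite_functional q 1 = (1 - q) * (2 * qHermite_weight q 1) * qpoch_inf (- q) q"
    using LIMSEQ_unique by blast
  then show ?thesis
    using qpoch_inf_shift[OF assms, of "- 1"]
    by (simp add: qHermite_norm2_def qHermite_weight_def qpoch_def binomial_eq_0)
qed

lemma qHermite_norm2_Suc:
  "qHermite_norm2 q (Suc n) = q ^ n * (1 - q ^ Suc n) * qHermite_norm2 q n"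
  by (simp add: qHermite_norm2_def qpoch_def numeral_2_eq_2 power_add)

lemma qHermite_norm2_pos:
  assumes "0 < q" "q < 1"
  shows "0 < qHermite_norm2 q n"
  unfolding qHermite_norm2_def using assms
  by (intro mult_pos_pos qpoch_inf_pos qpoch_pos zero_less_power) auto

text \<open>
  Applying the functional to the three-term recurrence and integrating the term \<open>x H\<^sub>n\<close> by parts
  gives \<open>L(H\<^sub>n\<^sub>+\<^sub>1) = (1 - q\<^sup>n) (1 - q\<^sup>n\<^sup>-\<^sup>1) L(H\<^sub>n\<^sub>-\<^sub>1)\<close>. For \<open>n = 0\<close> and
  \<open>n = 1\<close> the right-hand side vanishes because of its factors, for larger \<open>n\<close> by induction.
\<close>

lemma qHermite_functional_qHermite:
  assumes "0 < q" "q < 1"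
  shows "qHermite_functional q (qHermite q (int n)) = (if n = 0 then qHermite_norm2 q 0 else 0)"
proof (induction n rule: less_induct)
  case (less n)
  let ?L = "qHermite_functional q"
  show ?case
  proof (cases n)
    case 0
    then show ?thesis by (simp add: qHermite_0 qHermite_functional_1[OF assms])
  next
    case (Suc k)
    have "?L ([:0, 1:] * qHermite q (int k)) = (1 - q ^ k) * ?L (qHermite q (int k - 1))"
      using assms unfolding qHermite_functional_by_parts[OF assms]
      by (simp add: qderiv_poly_qHermite qHermite_functional_linear)
    then have "?L (qHermite q (int n)) = (1 - q ^ k) * (1 - q ^ (k - 1)) * ?L (qHermite q (int k - 1))"
      unfolding qHermite_recurrence[OF assms] qHermite_functional_linear[OF assms]
      using Suc by (simp add: algebra_simps)
    also have "\<dots> = 0"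
    proof (cases "k \<le> 1")
      case True
      then show ?thesis by (cases k) auto
    next
      case False
      then have "int k - 1 = int (k - 1)" by simp
      then show ?thesis using less[of "k - 1"] Suc False by simp
    qed
    finally show ?thesis using Suc by simp
  qed
qed

text \<open>
  As in the proof of Favard's theorem, the recurrence lets one move a factor \<open>x\<close> from
  one polynomial to the other, which lowers the smaller index until it is \<open>0\<close> and \<open>L(H\<^sub>k)\<close> remains.
\<close>

lemma qHermite_orthogonal_le:
  assumes "0 < q" "q < 1" "m \<le> n"
  shows "qHermite_functional q (qHermite q (int m) * qHermite q (int n)) =
    (if m = n then qHermite_norm2 q m else 0)"
  using \<open>m \<le> n\<close>
proof (induction m arbitrary: n rule: less_induct)
  case (less m)
  let ?L = "qHermite_functional q" and ?H = "\<lambda>n. qHermite q (int n)"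
  note lin = qHermite_functional_linear[OF assms(1,2)]
  show ?case
  proof (cases m)
    case 0
    then show ?thesis
      using qHermite_functional_qHermite[OF assms(1,2), of n] by (auto simp: qHermite_0)
  next
    case (Suc k)
    then obtain l where n: "n = Suc l" and "k \<le> l" using less.prems by (cases n) auto
    define \<gamma> where "\<gamma> n = q ^ (n - 1) * (1 - q ^ n)" for n
    have "?H m = [:0, 1:] * ?H k - smult (\<gamma> k) (qHermite q (int k - 1))"
      using qHermite_recurrence[OF assms(1,2), of k] Suc by (simp add: \<gamma>_def add.commute)
    from arg_cong[OF this, of "\<lambda>p. p * ?H n"]
    have "?H m * ?H n = ?H k * ([:0, 1:] * ?H n) - smult (\<gamma> k) (qHermite q (int k - 1) * ?H n)"
      by (simp only: left_diff_distrib right_diff_distrib mult_smult_left mult_smult_right mult_ac)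
    also have "[:0, 1:] * ?H n = ?H (Suc n) + smult (\<gamma> n) (?H l)"
      using qHermite_recurrence[OF assms(1,2), of n] n by (simp add: \<gamma>_def add.commute)
    finally have "?L (?H m * ?H n) = ?L (?H k * ?H (Suc n)) + \<gamma> n * ?L (?H k * ?H l)
        - \<gamma> k * ?L (qHermite q (int k - 1) * ?H n)"
      by (simp add: distrib_left lin)
    also have "?L (?H k * ?H (Suc n)) = 0"
      using less.IH[of k "Suc n"] Suc n \<open>k \<le> l\<close> by simp
    also have "?L (qHermite q (int k - 1) * ?H n) = 0"
    proof (cases k)
      case 0
      then show ?thesis by (simp add: qHermite_neg lin)
    next
      case (Suc i)
      then show ?thesis using less.IH[of i n] \<open>m = Suc k\<close> n \<open>k \<le> l\<close> by simp
    qed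
    also have "?L (?H k * ?H l) = (if k = l then qHermite_norm2 q k else 0)"
      using less.IH[of k l] Suc \<open>k \<le> l\<close> by simp
    finally show ?thesis
      using Suc n by (simp add: \<gamma>_def qHermite_norm2_Suc)
  qed
qed

lemma qHermite_orthogonal:
  assumes "0 < q" "q < 1"
  shows "qHermite_functional q (qHermite q (int m) * qHermite q (int n)) =
    (if m = n then qHermite_norm2 q m else 0)"
  using qHermite_orthogonal_le[OF assms, of m n] qHermite_orthogonal_le[OF assms, of n m]
  by (cases "m \<le> n") (auto simp: mult.commute)

section \<open>Expansion of the Sobolev polynomials\<close>

lemma expand_in_monic_sequence:
  fixes B :: "nat \<Rightarrow> 'a::comm_ring_1 poly"
  assumes "\<And>k. degree (B k) = k \<and> lead_coeff (B k) = 1"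
    and "\<And>i. n \<le> i \<Longrightarrow> coeff p i = 0"
  shows "\<exists>c. p = (\<Sum>k<n. smult (c k) (B k))"
  using assms(2)
proof (induction n arbitrary: p)
  case 0
  then show ?case by (auto simp: poly_eq_iff)
next
  case (Suc n)
  have B: "coeff (B n) n = 1" "\<And>i. n < i \<Longrightarrow> coeff (B n) i = 0"
    using assms(1)[of n] by (auto intro: coeff_eq_0)
  have "coeff (p - smult (coeff p n) (B n)) i = 0" if "n \<le> i" for i
    using that B Suc.prems[of i] by (cases "i = n") auto
  from Suc.IH[OF this] obtain c where
    "p - smult (coeff p n) (B n) = (\<Sum>k<n. smult (c k) (B k))" by blast
  then have "p = (\<Sum>k<n. smult (c k) (B k)) + smult (coeff p n) (B n)"
    by (simp add: algebra_simps)
  also have "\<dots> = (\<Sum>k<Suc n. smult ((c(n := coeff p n)) k) (B k))"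
    by simp
  finally show ?case by blast
qed

lemma qsobolev_inner_eq:
  assumes "q \<noteq> 1"
  shows "qsobolev_inner q \<alpha> j lam f g = qHermite_functional q (f * g)
    + lam * poly ((qderiv_poly q ^^ j) f) \<alpha> * poly ((qderiv_poly q ^^ j) g) \<alpha>"
  by (simp add: qsobolev_inner_def qHermite_functional_def qHermite_weight_def
      funpow_qderiv_poly[OF assms])

lemma qsobolev_orthogonal_lower_degree:
  assumes "0 < q" "q < 1" and S: "qHermite_Sobolev_seq q \<alpha> j lam S"
    and p: "\<And>i. n \<le> i \<Longrightarrow> coeff p i = 0"
  shows "qsobolev_inner q \<alpha> j lam (S n) p = 0"
proof -
  have q1: "q \<noteq> 1" using assms by simp
  obtain c where c: "p = (\<Sum>k<n. smult (c k) (S k))"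
    using expand_in_monic_sequence[of S n p] p S unfolding qHermite_Sobolev_seq_def by blast
  have "qsobolev_inner q \<alpha> j lam (S n) p = (\<Sum>k<n. c k * qsobolev_inner q \<alpha> j lam (S n) (S k))"
    unfolding c qsobolev_inner_eq[OF q1] funpow_qderiv_poly_linear[OF q1] sum_distrib_left
      qHermite_functional_sum[OF assms(1,2)] mult_smult_right qHermite_functional_linear[OF assms(1,2)]
      poly_sum poly_smult
    by (simp add: sum.distrib[symmetric] algebra_simps)
  also have "\<dots> = 0"
    using S by (intro sum.neutral) (auto simp: qHermite_Sobolev_seq_def)
  finally show ?thesis .
qed

text \<open>
  Expand \<open>S\<^sub>n - H\<^sub>n\<close>, of degree below \<open>n\<close>, in the \<open>H\<^sub>k\<close>. The Fourier coefficients are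
  \<open>L(S\<^sub>n H\<^sub>k) / \<parallel>H\<^sub>k\<parallel>\<^sup>2\<close>, and Sobolev orthogonality of \<open>S\<^sub>n\<close> to \<open>H\<^sub>k\<close> turns \<open>L(S\<^sub>n H\<^sub>k)\<close> into a
  multiple of \<open>(D\<^sub>q\<^sup>j S\<^sub>n)(\<alpha>)\<close>.
\<close>

lemma qHermite_Sobolev_expansion:
  assumes "0 < q" "q < 1" and S: "qHermite_Sobolev_seq q \<alpha> j lam S"
  shows "S n = qHermite q (int n) - (\<Sum>k<n. smult (lam * poly ((qderiv_poly q ^^ j) (S n)) \<alpha>
      * poly ((qderiv_poly q ^^ j) (qHermite q (int k))) \<alpha> / qHermite_norm2 q k) (qHermite q (int k)))"
proof -
  let ?L = "qHermite_functional q" and ?H = "\<lambda>n. qHermite q (int n)"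
  note lin = qHermite_functional_linear[OF assms(1,2)] qHermite_functional_sum[OF assms(1,2)]
  have q1: "q \<noteq> 1" using assms by simp
  have "degree (S n) = n" "lead_coeff (S n) = 1"
    using S unfolding qHermite_Sobolev_seq_def by blast+
  then have Sn: "degree (S n) = n" "coeff (S n) n = 1" by simp_all
  have H: "degree (?H k) = k" "coeff (?H k) k = 1" for k
    using qHermite_monic[OF assms(1,2), of k] by auto
  have "coeff (S n - ?H n) i = 0" if "n \<le> i" for i
    using that Sn H[of n] coeff_eq_0[of "S n" i] coeff_eq_0[of "?H n" i] by (cases "i = n") auto
  then obtain c where c: "S n - ?H n = (\<Sum>k<n. smult (c k) (?H k))"
    using expand_in_monic_sequence[of ?H n "S n - ?H n"] qHermite_monic[OF assms(1,2)] by blast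
  have "c k = - (lam * poly ((qderiv_poly q ^^ j) (S n)) \<alpha>
      * poly ((qderiv_poly q ^^ j) (?H k)) \<alpha> / qHermite_norm2 q k)" if k: "k < n" for k
  proof -
    have "?L ((S n - ?H n) * ?H k) = (\<Sum>i<n. c i * ?L (?H i * ?H k))"
      unfolding c by (simp add: sum_distrib_right lin)
    also have "\<dots> = (\<Sum>i<n. if i = k then c i * qHermite_norm2 q k else 0)"
      by (intro sum.cong refl) (auto simp: qHermite_orthogonal[OF assms(1,2)])
    also have "\<dots> = c k * qHermite_norm2 q k"
      using k by simp
    finally have "?L (S n * ?H k) = c k * qHermite_norm2 q k"
      using k by (simp add: left_diff_distrib lin qHermite_orthogonal[OF assms(1,2)])
    moreover have "qsobolev_inner q \<alpha> j lam (S n) (?H k) = 0"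
      using k H[of k] by (intro qsobolev_orthogonal_lower_degree assms) (auto intro: coeff_eq_0)
    ultimately show ?thesis
      using qHermite_norm2_pos[OF assms(1,2), of k]
      by (simp add: qsobolev_inner_eq[OF q1] field_simps)
  qed
  then have "S n - ?H n = (\<Sum>k<n. - smult (lam * poly ((qderiv_poly q ^^ j) (S n)) \<alpha>
      * poly ((qderiv_poly q ^^ j) (?H k)) \<alpha> / qHermite_norm2 q k) (?H k))"
    unfolding c by (intro sum.cong refl) (simp add: smult_minus_left[symmetric] del: smult_minus_left)
  then show ?thesis
    by (simp add: sum_negf algebra_simps)
qed

text \<open>
  Applying \<open>D\<^sub>q\<^sup>j\<close> at \<open>\<alpha>\<close> to the expansion gives a linear equation for the unknown value
  \<open>A = (D\<^sub>q\<^sup>j S\<^sub>n)(\<alpha>)\<close>, namely \<open>A (1 + \<lambda> K(\<alpha>, \<alpha>)) = (D\<^sub>q\<^sup>j H\<^sub>n)(\<alpha>)\<close>. It is solvable because the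
  kernel is a sum of squares.
\<close>

theorem proposition5:
  fixes q \<alpha> lam :: real and j n :: nat and S :: "nat \<Rightarrow> real poly" and x :: real
  assumes "0 < q" and "q < 1"
    and "\<bar>\<alpha>\<bar> > 1"
    and "lam > 0"
    and "qHermite_Sobolev_seq q \<alpha> j lam S"
    and "n \<ge> 1"
  shows "poly (S n) x =
    poly (qHermite q (int n)) x
    - lam * (qfalling q n j * poly (qHermite q (int n - int j)) \<alpha>
             / (1 + lam * qHermite_kernel q (n - 1) j j \<alpha> \<alpha>))
      * qHermite_kernel q (n - 1) 0 j x \<alpha>"
proof -
  have q1: "q \<noteq> 1" using assms by simp
  define D where "D p = poly ((qderiv_poly q ^^ j) p) \<alpha>" for p
  define H where "H k = qHermite q (int k)" for k :: nat
  let ?K = "qHermite_kernel q (n - 1) j j \<alpha> \<alpha>"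
  have idx: "{..n - 1} = {..<n}" using \<open>n \<ge> 1\<close> by auto
  have K: "?K = (\<Sum>k<n. D (H k) * D (H k) / qHermite_norm2 q k)"
    "qHermite_kernel q (n - 1) 0 j x \<alpha> = (\<Sum>k<n. poly (H k) x * D (H k) / qHermite_norm2 q k)"
    unfolding qHermite_kernel_def idx
    by (simp_all add: funpow_qderiv_poly[OF q1] D_def H_def)
  have S: "S n = H n - (\<Sum>k<n. smult (lam * D (S n) * D (H k) / qHermite_norm2 q k) (H k))"
    using qHermite_Sobolev_expansion[OF assms(1,2,5), of n] by (simp only: D_def H_def)
  have "D (S n) = D (H n) - (\<Sum>k<n. lam * D (S n) * D (H k) / qHermite_norm2 q k * D (H k))"
    by (subst S) (simp only: D_def funpow_qderiv_poly_linear[OF q1] poly_diff poly_sum poly_smult)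
  also have "\<dots> = D (H n) - D (S n) * (lam * ?K)"
    unfolding K by (simp add: sum_distrib_left mult_ac)
  finally have "D (S n) * (1 + lam * ?K) = D (H n)"
    by (simp add: algebra_simps)
  moreover have "0 \<le> ?K"
    unfolding K using qHermite_norm2_pos[OF assms(1,2)]
    by (intro sum_nonneg divide_nonneg_pos) auto
  then have "1 + lam * ?K \<noteq> 0"
    using \<open>lam > 0\<close> by (metis add_pos_nonneg less_irrefl less_imp_le mult_nonneg_nonneg zero_less_one)
  moreover have "D (H n) = qfalling q n j * poly (qHermite q (int n - int j)) \<alpha>"
    by (simp add: D_def H_def funpow_qderiv_poly_qHermite[OF assms(1,2)])
  ultimately have A: "D (S n) =
      qfalling q n j * poly (qHermite q (int n - int j)) \<alpha> / (1 + lam * ?K)"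
    by (simp add: field_simps)
  have "poly (S n) x = poly (H n) x - (\<Sum>k<n. lam * D (S n) * D (H k) / qHermite_norm2 q k * poly (H k) x)"
    by (subst S) (simp only: poly_diff poly_sum poly_smult)
  also have "\<dots> = poly (H n) x - lam * D (S n) * qHermite_kernel q (n - 1) 0 j x \<alpha>"
    unfolding K by (simp add: sum_distrib_left mult_ac)
  finally show ?thesis
    by (simp only: A H_def)
qed

end
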